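(* Let $R$ be a transit function on a finite non-empty set $V$ satisfying $(P)$. Then the $R$-convexity $\mathcal{C}_R$ is a convex geometry if and only if $R$ satisfies $(b1)$ and $(J0)$.
   Context: A transit function on a finite non-empty set $V$ is a map $R:V\times V\to 2^V$ such that $u\in R(u,v)$, $R(u,v)=R(v,u)$ and $R(u,u)=\{u\}$ for all $u,v\in V$. A convexity on the finite set $V$ is a family of subsets of $V$ (called convex sets) containing $\emptyset$ and $V$ and closed under intersections; the convex hull of $A\subseteq V$ is the smallest convex set containing $A$. A set $S\subseteq V$ is $R$-convex if $R(u,v)\subseteq S$ for all $u,v\in S$; $\mathcal{C}_R$ denotes the convexity of all $R$-convex subsets of $V$. A point $k$ of a convex set $K$ is an extreme point of $K$ if $K\setminus\{k\}$ is convex. A convexity is a convex geometry if every convex set $K$ is the convex hull of the set of extreme points of $K$. Axioms on $R$: - $(P)$ (Peano axiom): for all $x,y,u,v,w\in V$ (not necessarily distinct), if $x\in R(u,v)$ and $y\in R(x,w)$, then there exists $z\in R(u,w)$ such that $y\in R(z,v)$. - $(b1)$: for all $u,v,x\in V$, if $x\in R(u,v)$ and $x\neq v$, then $v\notin R(u,x)$. - $(J0)$: for all pairwise distinct $u,v,x,y\in V$, if $x\in R(u,y)$ and $y\in R(x,v)$, then $x\in R(u,v)$. *)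

theory Defs
  imports Main "HOL.Hull"
begin

definition transit_function_on :: "'a set \<Rightarrow> ('a \<Rightarrow> 'a \<Rightarrow> 'a set) \<Rightarrow> bool" where
  "transit_function_on V R \<longleftrightarrow>
     (\<forall>u\<in>V. \<forall>v\<in>V. R u v \<subseteq> V \<and> u \<in> R u v \<and> R u v = R v u) \<and>
     (\<forall>u\<in>V. R u u = {u})"

definition convexity_on :: "'a set \<Rightarrow> 'a set set \<Rightarrow> bool" where
  "convexity_on V C \<longleftrightarrow>
     C \<subseteq> Pow V \<and> {} \<in> C \<and> V \<in> C \<and> (\<forall>F. F \<subseteq> C \<and> F \<noteq> {} \<longrightarrow> \<Inter>F \<in> C)"

(* When C is a convexity on V and A is a subset of V, this is the smallest member of C
   containing A: the members of C containing A are closed under intersection and include V. *)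
definition convex_hull_in :: "'a set set \<Rightarrow> 'a set \<Rightarrow> 'a set" where
  "convex_hull_in C A = (\<lambda>K. K \<in> C) hull A"

definition extreme_points :: "'a set set \<Rightarrow> 'a set \<Rightarrow> 'a set" where
  "extreme_points C K = {k \<in> K. K - {k} \<in> C}"

definition convex_geometry_on :: "'a set \<Rightarrow> 'a set set \<Rightarrow> bool" where
  "convex_geometry_on V C \<longleftrightarrow>
     convexity_on V C \<and> (\<forall>K\<in>C. K = convex_hull_in C (extreme_points C K))"

definition R_convexity :: "'a set \<Rightarrow> ('a \<Rightarrow> 'a \<Rightarrow> 'a set) \<Rightarrow> 'a set set" where
  "R_convexity V R = {S. S \<subseteq> V \<and> (\<forall>u\<in>S. \<forall>v\<in>S. R u v \<subseteq> S)}"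

definition axiom_P :: "'a set \<Rightarrow> ('a \<Rightarrow> 'a \<Rightarrow> 'a set) \<Rightarrow> bool" where
  "axiom_P V R \<longleftrightarrow>
     (\<forall>x\<in>V. \<forall>y\<in>V. \<forall>u\<in>V. \<forall>v\<in>V. \<forall>w\<in>V.
        x \<in> R u v \<and> y \<in> R x w \<longrightarrow> (\<exists>z\<in>R u w. y \<in> R z v))"

definition axiom_b1 :: "'a set \<Rightarrow> ('a \<Rightarrow> 'a \<Rightarrow> 'a set) \<Rightarrow> bool" where
  "axiom_b1 V R \<longleftrightarrow>
     (\<forall>u\<in>V. \<forall>v\<in>V. \<forall>x\<in>V. x \<in> R u v \<and> x \<noteq> v \<longrightarrow> v \<notin> R u x)"

definition axiom_J0 :: "'a set \<Rightarrow> ('a \<Rightarrow> 'a \<Rightarrow> 'a set) \<Rightarrow> bool" where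
  "axiom_J0 V R \<longleftrightarrow>
     (\<forall>u\<in>V. \<forall>v\<in>V. \<forall>x\<in>V. \<forall>y\<in>V.
        distinct [u, v, x, y] \<and> x \<in> R u y \<and> y \<in> R x v \<longrightarrow> x \<in> R u v)"

end

theory Submission
  imports Defs
begin

text \<open>
  The Peano axiom makes segments convex and makes the hull of a nonempty convex set M and a point p
  equal to the union of the segments from p to points of M. If the convexity is a geometry, a
  failure of (b1) or (J0) yields a hull of two to four named points in which too many of them are
  non-extreme. Conversely, if K is not the hull of its extreme points, take a maximal proper convex
  subset M of K containing them; for distinct p, q in K - M one gets q in R(a,p) and p in R(b,q)
  with a, b in M, which contradicts (b1) if a = b and (J0) otherwise. So K - M is a single point,
  which is extreme in K but not in M.
\<close>

locale peano_transit =
  fixes V :: "'a set" and R :: "'a \<Rightarrow> 'a \<Rightarrow> 'a set"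
  assumes transit: "transit_function_on V R"
    and peano: "axiom_P V R"
begin

abbreviation "\<C> \<equiv> R_convexity V R"

section \<open>Segments and joins under the Peano axiom\<close>

lemma R_subset: "u \<in> V \<Longrightarrow> v \<in> V \<Longrightarrow> R u v \<subseteq> V"
  and R_left: "u \<in> V \<Longrightarrow> v \<in> V \<Longrightarrow> u \<in> R u v"
  and R_sym: "u \<in> V \<Longrightarrow> v \<in> V \<Longrightarrow> R u v = R v u"
  and R_self: "u \<in> V \<Longrightarrow> R u u = {u}"
  using transit unfolding transit_function_on_def by blast+

lemma R_right: "u \<in> V \<Longrightarrow> v \<in> V \<Longrightarrow> v \<in> R u v"
  using R_left R_sym by blast

lemma R_mem: "u \<in> V \<Longrightarrow> v \<in> V \<Longrightarrow> x \<in> R u v \<Longrightarrow> x \<in> V"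
  using R_subset by blast

lemma peanoE:
  assumes "u \<in> V" "v \<in> V" "w \<in> V" "x \<in> R u v" "y \<in> R x w"
  obtains z where "z \<in> R u w" "z \<in> V" "y \<in> R z v"
proof -
  have "x \<in> V"
    using R_mem assms(1,2,4) .
  then have "y \<in> V"
    using R_mem assms(3,5) by blast
  then have "\<exists>z\<in>R u w. y \<in> R z v"
    using peano assms \<open>x \<in> V\<close> unfolding axiom_P_def by blast
  then show thesis
    using that R_mem[OF assms(1,3)] by blast
qed

text \<open>The degenerate case \<open>w = u\<close> of the Peano axiom: the point it supplies lies
  in \<open>R u u = {u}\<close>, so it is \<open>u\<close> itself.\<close>

lemma R_mono:
  assumes "u \<in> V" "v \<in> V" "x \<in> R u v"
  shows "R u x \<subseteq> R u v"
proof
  fix y assume "y \<in> R u x"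
  then have "y \<in> R x u"
    using R_sym R_mem assms by blast
  then obtain z where "z \<in> R u u" "y \<in> R z v"
    using peanoE[OF assms(1,2,1,3)] by metis
  then show "y \<in> R u v"
    using R_self assms(1) by simp
qed

lemma R_mono':
  assumes "u \<in> V" "v \<in> V" "x \<in> R u v"
  shows "R x v \<subseteq> R u v"
proof -
  have "x \<in> V"
    using R_mem assms .
  then show ?thesis
    using R_mono[of v u x] R_sym[of u v] R_sym[of x v] assms by simp
qed

lemma convexity: "convexity_on V \<C>"
proof -
  have "\<Inter>F \<in> \<C>" if F: "F \<subseteq> \<C>" "F \<noteq> {}" for F
  proof -
    have sub: "S \<subseteq> V \<and> (\<forall>u\<in>S. \<forall>v\<in>S. R u v \<subseteq> S)" if "S \<in> F" for S
      using F(1) that unfolding R_convexity_def by blast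
    have "R u v \<subseteq> \<Inter>F" if "u \<in> \<Inter>F" "v \<in> \<Inter>F" for u v
      by (rule Inter_greatest) (use sub that in simp)
    moreover have "\<Inter>F \<subseteq> V"
      using F(2) sub by blast
    ultimately show ?thesis
      unfolding R_convexity_def by simp
  qed
  moreover have "\<C> \<subseteq> Pow V" "{} \<in> \<C>" "V \<in> \<C>"
    using R_subset by (auto simp: R_convexity_def)
  ultimately show ?thesis
    unfolding convexity_on_def by simp
qed

lemma convex_Int: "A \<in> \<C> \<Longrightarrow> B \<in> \<C> \<Longrightarrow> A \<inter> B \<in> \<C>"
  unfolding R_convexity_def by blast

lemma convex_subset: "A \<in> \<C> \<Longrightarrow> A \<subseteq> V"
  and convex_R_subset: "A \<in> \<C> \<Longrightarrow> u \<in> A \<Longrightarrow> v \<in> A \<Longrightarrow> R u v \<subseteq> A"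
  unfolding R_convexity_def by blast+

lemma convex_singleton: "u \<in> V \<Longrightarrow> {u} \<in> \<C>"
  using R_self unfolding R_convexity_def by blast

text \<open>Two uses of the Peano axiom bring a point \<open>t\<close> between two segments ending
  in \<open>p\<close> onto one segment from a point \<open>r\<close> of \<open>M\<close> to
  \<open>p\<close>. The first trades \<open>y\<close> for \<open>s\<close> between \<open>a\<close>
  and \<open>z\<close>; the second trades \<open>z\<close> for \<open>r\<close> between
  \<open>b\<close> and \<open>a\<close>.\<close>

lemma convex_join:
  assumes M: "M \<in> \<C>" and p: "p \<in> V"
  shows "(\<Union>a\<in>M. R a p) \<in> \<C>"
proof -
  have "t \<in> (\<Union>a\<in>M. R a p)"
    if a: "a \<in> M" and b: "b \<in> M" and y: "y \<in> R a p" and z: "z \<in> R b p" and t: "t \<in> R y z"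
    for a b y z t
  proof -
    have V: "a \<in> V" "b \<in> V" "z \<in> V"
      using a b z p convex_subset[OF M] R_mem by blast+
    obtain s where s: "s \<in> R a z" "t \<in> R s p"
      using peanoE[OF V(1) p V(3) y t] .
    then have "s \<in> R z a"
      using R_sym V by blast
    then obtain r where r: "r \<in> R b a" "r \<in> V" "s \<in> R r p"
      using peanoE[OF V(2) p V(1) z] by metis
    \<comment> \<open>Since \<open>s\<close> lies on the segment from \<open>r\<close> to
      \<open>p\<close>, monotonicity absorbs \<open>R s p\<close> into \<open>R r p\<close>.\<close>
    then have "t \<in> R r p"
      using R_mono'[OF r(2) p r(3)] s by blast
    then show ?thesis
      using r convex_R_subset[OF M b a] by blast
  qed
  then have "R y z \<subseteq> (\<Union>a\<in>M. R a p)" if "y \<in> (\<Union>a\<in>M. R a p)" "z \<in> (\<Union>a\<in>M. R a p)" for y z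
    using that by (metis UN_E subsetI)
  moreover have "(\<Union>a\<in>M. R a p) \<subseteq> V"
    using R_subset convex_subset[OF M] p by blast
  ultimately show ?thesis
    unfolding R_convexity_def by simp
qed

lemma convex_segment: "u \<in> V \<Longrightarrow> v \<in> V \<Longrightarrow> R u v \<in> \<C>"
  using convex_join[OF convex_singleton] by simp

section \<open>From a convex geometry to (b1) and (J0)\<close>

lemma not_extreme:
  assumes "x \<in> R u v" "u \<in> K" "v \<in> K" "x \<noteq> u" "x \<noteq> v"
  shows "x \<notin> extreme_points \<C> K"
  using assms unfolding extreme_points_def R_convexity_def by blast

text \<open>The form in which the geometry hypothesis is applied: \<open>S\<close> becomes
  \<open>{u}\<close> for (b1) and \<open>R u v\<close> for (J0).\<close>

lemma geometry_imp_subset: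
  assumes "convex_geometry_on V \<C>" "K \<in> \<C>" "S \<in> \<C>" "extreme_points \<C> K \<subseteq> S"
  shows "K \<subseteq> S"
  using assms hull_minimal[of "extreme_points \<C> K" S "\<lambda>K. K \<in> \<C>"]
  unfolding convex_geometry_on_def convex_hull_in_def by blast

lemma geometry_imp_b1:
  assumes G: "convex_geometry_on V \<C>"
  shows "axiom_b1 V R"
  unfolding axiom_b1_def
proof (intro ballI impI notI)
  fix u v x
  assume V: "u \<in> V" "v \<in> V" "x \<in> V" and x: "x \<in> R u v \<and> x \<noteq> v" and v: "v \<in> R u x"
  have "v \<noteq> u"
    using x V R_self by blast
  \<comment> \<open>Both \<open>u\<close> and \<open>x\<close> lie in \<open>R u v\<close>, and
    \<open>v\<close> is strictly between them, so the segment loses its endpoint \<open>v\<close> as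
    an extreme point.\<close>
  then have "v \<notin> extreme_points \<C> (R u v)"
    using not_extreme[OF v R_left] V x by blast
  moreover have "k = u \<or> k = v" if "k \<in> extreme_points \<C> (R u v)" for k
    using that not_extreme[OF _ R_left R_right] V unfolding extreme_points_def by blast
  ultimately have "extreme_points \<C> (R u v) \<subseteq> {u}"
    by blast
  then have "R u v \<subseteq> {u}"
    using geometry_imp_subset[OF G convex_segment convex_singleton] V by blast
  then show False
    using R_right V \<open>v \<noteq> u\<close> by blast
qed

lemma geometry_imp_J0:
  assumes G: "convex_geometry_on V \<C>"
  shows "axiom_J0 V R"
  unfolding axiom_J0_def
proof (intro ballI impI)
  fix u v x y
  assume V: "u \<in> V" "v \<in> V" "x \<in> V" "y \<in> V"
    and xy: "distinct [u, v, x, y] \<and> x \<in> R u y \<and> y \<in> R x v"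
  define K where "K = \<Inter>{S \<in> \<C>. {u, v, x, y} \<subseteq> S}"
  \<comment> \<open>\<open>convexity_on\<close> closes only nonempty families under intersection;
    \<open>V\<close> is a member of this one.\<close>
  have "{S \<in> \<C>. {u, v, x, y} \<subseteq> S} \<noteq> {}"
    using V convexity unfolding convexity_on_def by blast
  then have K: "K \<in> \<C>"
    unfolding K_def using convexity unfolding convexity_on_def by simp
  have mem: "{u, v, x, y} \<subseteq> K"
    unfolding K_def by blast
  have least: "K \<subseteq> S" if "S \<in> \<C>" "{u, v, x, y} \<subseteq> S" for S
    unfolding K_def using that by (intro Inter_lower) simp
  \<comment> \<open>Extreme points of a hull are generators: removing any other extreme point would
    leave a smaller convex set containing all four.\<close>
  have "k \<in> {u, v, x, y}" if "k \<in> extreme_points \<C> K" for k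
  proof (rule ccontr)
    assume "k \<notin> {u, v, x, y}"
    then have "K \<subseteq> K - {k}"
      using that mem least[of "K - {k}"] unfolding extreme_points_def by blast
    then show False
      using that unfolding extreme_points_def by blast
  qed
  moreover have "x \<notin> extreme_points \<C> K" "y \<notin> extreme_points \<C> K"
    using not_extreme[of x u y K] not_extreme[of y x v K] xy mem by auto
  ultimately have "extreme_points \<C> K \<subseteq> R u v"
    using R_left R_right V by blast
  then have "K \<subseteq> R u v"
    using geometry_imp_subset[OF G K convex_segment] V by blast
  then show "x \<in> R u v"
    using mem by blast
qed

section \<open>From (b1) and (J0) to a convex geometry\<close>

lemma maximal_convex_subset:
  assumes b1: "axiom_b1 V R" and J0: "axiom_J0 V R"
    and K: "K \<in> \<C>" and M: "M \<in> \<C>" "M \<subseteq> K"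
    and max: "\<And>N. N \<in> \<C> \<Longrightarrow> M \<subset> N \<Longrightarrow> N \<subseteq> K \<Longrightarrow> N = K"
    and p: "p \<in> K - M" and q: "q \<in> K - M"
  shows "p = q"
proof (rule ccontr)
  assume "p \<noteq> q"
  have V: "p \<in> V" "q \<in> V"
    using p q convex_subset[OF K] by blast+
  \<comment> \<open>The join of the empty set with a point is empty, so this case is excluded first:
    here \<open>{p}\<close> would already be all of \<open>K\<close>.\<close>
  have "M \<noteq> {}"
  proof
    assume "M = {}"
    then have "{p} = K"
      using max[OF convex_singleton] V p by blast
    then show False
      using q \<open>p \<noteq> q\<close> by blast
  qed
  \<comment> \<open>The join contains \<open>M\<close> and also \<open>r\<close>, so by maximality
    of \<open>M\<close> it exhausts \<open>K\<close>. Each of \<open>p\<close> and \<open>q\<close>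
    is thus reached by a segment from \<open>M\<close> to the other.\<close>
  have join: "(\<Union>a\<in>M. R a r) = K" if r: "r \<in> K - M" for r
  proof (rule max)
    have rV: "r \<in> V"
      using r convex_subset[OF K] by blast
    then show "(\<Union>a\<in>M. R a r) \<in> \<C>"
      using convex_join M by blast
    have "a \<in> R a r \<and> r \<in> R a r" if "a \<in> M" for a
      using R_left R_right rV convex_subset[OF M(1)] that by blast
    then show "M \<subset> (\<Union>a\<in>M. R a r)"
      using \<open>M \<noteq> {}\<close> r by blast
    show "(\<Union>a\<in>M. R a r) \<subseteq> K"
      using convex_R_subset[OF K] M r by blast
  qed
  obtain a b where a: "a \<in> M" "q \<in> R a p" and b: "b \<in> M" "p \<in> R b q"
    using join[OF p] join[OF q] p q by blast
  have abV: "a \<in> V" "b \<in> V"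
    using a b convex_subset[OF M(1)] by blast+
  show False
  proof (cases "a = b")
    case True
    then show ?thesis
      using b1 a b abV V \<open>p \<noteq> q\<close> unfolding axiom_b1_def by blast
  next
    case False
    have "distinct [a, b, q, p]"
      using False \<open>p \<noteq> q\<close> a(1) b(1) p q by auto
    moreover have "p \<in> R q b"
      using b R_sym abV V by blast
    \<comment> \<open>(J0) along the chain \<open>a\<close>, \<open>q\<close>, \<open>p\<close>,
      \<open>b\<close> puts \<open>q\<close> between two points of \<open>M\<close>, hence in
      \<open>M\<close>.\<close>
    ultimately have "q \<in> R a b"
      using J0 a abV V unfolding axiom_J0_def by blast
    then show False
      using convex_R_subset[OF M(1) a(1) b(1)] q by blast
  qed
qed

lemma b1_J0_imp_geometry:
  assumes fin: "finite V" and b1: "axiom_b1 V R" and J0: "axiom_J0 V R"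
  shows "convex_geometry_on V \<C>"
proof -
  have least: "K \<subseteq> S" if K: "K \<in> \<C>" and S: "S \<in> \<C>" "extreme_points \<C> K \<subseteq> S" for K S
  proof (rule ccontr)
    assume "\<not> K \<subseteq> S"
    \<comment> \<open>The proper convex subsets of \<open>K\<close> that keep all its extreme
      points. The set \<open>K \<inter> S\<close> is one of them, and finiteness of \<open>V\<close>
      gives a maximal one.\<close>
    let ?F = "{N \<in> \<C>. extreme_points \<C> K \<subseteq> N \<and> N \<subset> K}"
    have "?F \<subseteq> Pow V"
      using convex_subset[OF K] by auto
    then have "finite ?F"
      by (rule finite_subset) (simp add: fin)
    moreover have "K \<inter> S \<in> ?F"
      using convex_Int[OF K S(1)] S(2) \<open>\<not> K \<subseteq> S\<close> unfolding extreme_points_def by blast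
    ultimately have "\<exists>M\<in>?F. \<forall>N\<in>?F. M \<subseteq> N \<longrightarrow> M = N"
      by (intro finite_has_maximal) (assumption, metis empty_iff)
    then obtain M where M: "M \<in> ?F" and max: "\<forall>N\<in>?F. M \<subseteq> N \<longrightarrow> M = N"
      by (rule bexE)
    obtain p where p: "p \<in> K - M"
      using M by blast
    have maxK: "N = K" if "N \<in> \<C>" "M \<subset> N" "N \<subseteq> K" for N
    proof (rule ccontr)
      assume "N \<noteq> K"
      then have "N \<in> ?F"
        using M that by auto
      then show False
        using max that(2) by auto
    qed
    have "M \<in> \<C>" "M \<subseteq> K"
      using M by auto
    then have "p = q" if "q \<in> K - M" for q
      using maximal_convex_subset[OF b1 J0 K _ _ maxK p that] by simp
    \<comment> \<open>With only \<open>p\<close> missing from \<open>M\<close>, convexity of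
      \<open>M\<close> makes \<open>p\<close> extreme in \<open>K\<close>, although \<open>M\<close>
      contains every extreme point.\<close>
    then have "K - {p} = M"
      using M p by blast
    then have "p \<in> extreme_points \<C> K"
      using M p unfolding extreme_points_def by blast
    then show False
      using M p by blast
  qed
  have "K = convex_hull_in \<C> (extreme_points \<C> K)" if "K \<in> \<C>" for K
    unfolding convex_hull_in_def
    \<comment> \<open>\<open>least\<close> supplies the minimality of \<open>K\<close> among convex
      sets containing its extreme points.\<close>
    by (rule hull_unique[symmetric]) (use least that in \<open>auto simp: extreme_points_def\<close>)
  then show ?thesis
    using convexity unfolding convex_geometry_on_def by blast
qed

end

theorem theorem2p15:
  fixes V :: "'a set" and R :: "'a \<Rightarrow> 'a \<Rightarrow> 'a set"
  assumes "finite V" and "V \<noteq> {}"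
    and "transit_function_on V R"
    and "axiom_P V R"
  shows "convex_geometry_on V (R_convexity V R) \<longleftrightarrow> axiom_b1 V R \<and> axiom_J0 V R"
proof -
  interpret peano_transit V R
    by unfold_locales (fact assms)+
  show ?thesis
    using geometry_imp_b1 geometry_imp_J0 b1_J0_imp_geometry[OF \<open>finite V\<close>] by (intro iffI) simp_all
qed

end
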